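(* Let $S$ be an almost integral semiring. Then the following are equivalent: (i) $S$ is subdirectly irreducible. (ii) $S$ has a zero element $0\in S$ and a least non-zero element $e\in S$ (i.e. $e\neq 0$ and $e\leq x$ for every $x\in S\setminus\{0\}$). Also, for all $a,b\in S$ with $a\not\leq b$ there are $c,d\in S^1$ such that $cad\neq 0=cbd$. If any of these conditions is fulfilled, then the least non-identical congruence $\sigma$ of $S$ is of the form $\sigma=\{(0,e),(e,0)\}\cup id_S$.
   Context: A semiring $S(+,\cdot)$ is a non-empty set with two associative binary operations such that $+$ is commutative and $\cdot$ distributes over $+$ from both sides (no zero or unity is required). It is additively idempotent if $a+a=a$ for all $a\in S$; then $S$ is ordered by $a\leq b$ iff $a+b=b$. $S$ is almost integral if it is additively idempotent and $ab\leq a$ and $ba\leq a$ for all $a,b\in S$. A zero is an element $0$ with $a0=0=0a$ and $a+0=a$ for all $a\in S$. $S^1$ denotes the smallest multiplicative monoid containing the semigroup $S(\cdot)$ (i.e. $S^1=S$ if $S$ has a unity, and otherwise $S^1$ is $S$ with a new identity element adjoined). A congruence on $S$ is an equivalence relation preserved under addition and multiplication. $S$ is subdirectly irreducible if there is a least (with respect to inclusion) congruence among the congruences of $S$ different from the identity relation $id_S$; in particular at least one such congruence exists. *)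

theory Defs
  imports Main
begin

text \<open>The class \<^class>\<open>semiring\<close> is used as the notion of semiring: it requires neither a zero
  nor a unity. Since a semiring is a type here, non-emptiness is automatic.\<close>

definition (in semiring) sr_le :: "'a \<Rightarrow> 'a \<Rightarrow> bool" (infix "\<preceq>" 50)
  where "a \<preceq> b \<longleftrightarrow> a + b = b"

class almost_integral_semiring = semiring +
  assumes add_idem: "a + a = a"
    and mult_le_left: "a * b \<preceq> a"
    and mult_le_right: "b * a \<preceq> a"

definition is_zero :: "'a::semiring \<Rightarrow> bool"
  where "is_zero z \<longleftrightarrow> (\<forall>a. a * z = z \<and> z * a = z \<and> a + z = a)"

definition is_unity :: "'a::semiring \<Rightarrow> bool"
  where "is_unity u \<longleftrightarrow> (\<forall>a. u * a = a \<and> a * u = a)"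

definition is_least_nonzero :: "'a::semiring \<Rightarrow> 'a \<Rightarrow> bool"
  where "is_least_nonzero z e \<longleftrightarrow> e \<noteq> z \<and> (\<forall>x. x \<noteq> z \<longrightarrow> e \<preceq> x)"

text \<open>The monoid $S^1$ lives on a subset of the option type: \<^term>\<open>Some\<close> is the embedding of $S$, and
  \<^term>\<open>None\<close> is the adjoined identity, which belongs to the carrier only if $S$ has no unity.\<close>

definition S1 :: "'a::semiring option set"
  where "S1 = (if \<exists>u::'a. is_unity u then range Some else insert None (range Some))"

fun mult1 :: "'a::semiring option \<Rightarrow> 'a option \<Rightarrow> 'a option" (infixl "\<cdot>\<^sub>1" 70)
  where
    "None \<cdot>\<^sub>1 y = y"
  | "Some a \<cdot>\<^sub>1 None = Some a"
  | "Some a \<cdot>\<^sub>1 Some b = Some (a * b)"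

lemma S1_closed: "x \<in> S1 \<Longrightarrow> y \<in> S1 \<Longrightarrow> x \<cdot>\<^sub>1 y \<in> S1"
  by (cases x; cases y) (auto simp: S1_def split: if_splits)

lemma mult1_assoc: "(x \<cdot>\<^sub>1 y) \<cdot>\<^sub>1 z = x \<cdot>\<^sub>1 (y \<cdot>\<^sub>1 z)"
  by (cases x; cases y; cases z) (auto simp: mult.assoc)

lemma S1_identity: "\<exists>u \<in> S1. \<forall>x \<in> S1. u \<cdot>\<^sub>1 x = x \<and> x \<cdot>\<^sub>1 u = (x :: 'a::semiring option)"
proof (cases "\<exists>u::'a. is_unity u")
  case True
  then obtain u :: 'a where "is_unity u" by blast
  then show ?thesis using True
    by (intro bexI[of _ "Some u"]) (auto simp: S1_def is_unity_def)
next
  case False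
  then show ?thesis
    by (intro bexI[of _ None]) (auto simp: S1_def)
qed

definition congruence :: "('a::semiring \<times> 'a) set \<Rightarrow> bool"
  where "congruence r \<longleftrightarrow> equiv UNIV r \<and>
    (\<forall>a b c d. (a, b) \<in> r \<longrightarrow> (c, d) \<in> r \<longrightarrow> (a + c, b + d) \<in> r \<and> (a * c, b * d) \<in> r)"

definition is_least_nonid_congruence :: "('a::semiring \<times> 'a) set \<Rightarrow> bool"
  where "is_least_nonid_congruence s \<longleftrightarrow> congruence s \<and> s \<noteq> Id \<and>
    (\<forall>r. congruence r \<and> r \<noteq> Id \<longrightarrow> s \<subseteq> r)"

definition subdirectly_irreducible :: "'a::semiring itself \<Rightarrow> bool"
  where "subdirectly_irreducible _ \<longleftrightarrow> (\<exists>s::('a \<times> 'a) set. is_least_nonid_congruence s)"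

end

(* For (i) => (ii), the relation "cxd <= a iff cyd <= a for all c, d in S^1" is a congruence for
   every a in S. If (u, v) lies in the least non-identical congruence and u < v, then this relation
   with a = u does not contain (u, v), so it is the identity. By almost integrality it identifies all
   elements below u, so u is minimal, hence the zero; and its being the identity is the separation
   property. The congruences x + a = y + a then show that v is the least non-zero element. For
   (ii) => (i), separation turns any pair of distinct congruent elements into a pair (s, 0) with
   s nonzero, and adding e gives (e, 0). *)

theory Submission
  imports Defs
begin

context almost_integral_semiring
begin

lemma sr_le_refl: "a \<preceq> a"
  by (simp add: sr_le_def add_idem)

lemma sr_le_antisym: "a \<preceq> b \<Longrightarrow> b \<preceq> a \<Longrightarrow> a = b"
  by (metis sr_le_def add.commute)

lemma sr_le_trans: "a \<preceq> b \<Longrightarrow> b \<preceq> c \<Longrightarrow> a \<preceq> c"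
  by (metis sr_le_def add.assoc)

lemma sr_le_add: "a \<preceq> a + b"
  by (simp add: sr_le_def add.assoc[symmetric] add_idem)

lemma add_sr_le_iff: "a + b \<preceq> c \<longleftrightarrow> a \<preceq> c \<and> b \<preceq> c"
  by (metis sr_le_def sr_le_add sr_le_trans add.assoc add.commute)

end

text \<open>The middle factor of the product lies in S, so the product is never \<open>None\<close>
  and \<open>the\<close> is always well defined.\<close>

definition act :: "'a::semiring option \<Rightarrow> 'a \<Rightarrow> 'a option \<Rightarrow> 'a"
  where "act c x d = the (c \<cdot>\<^sub>1 Some x \<cdot>\<^sub>1 d)"

lemma mult1_eq_act: "c \<cdot>\<^sub>1 Some x \<cdot>\<^sub>1 d = Some (act c x d)"
  by (cases c; cases d) (auto simp: act_def)

lemma act_add: "act c (x + y) d = act c x d + act c y d"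
  by (cases c; cases d) (auto simp: act_def algebra_simps)

lemma act_mult_right: "act c (x * y) d = act c x (Some y \<cdot>\<^sub>1 d)"
  by (cases c; cases d) (auto simp: act_def algebra_simps)

lemma act_mult_left: "act c (y * x) d = act (c \<cdot>\<^sub>1 Some y) x d"
  by (cases c; cases d) (auto simp: act_def algebra_simps)

lemma act_le: "act c x d \<preceq> (x :: 'a::almost_integral_semiring)"
  by (cases c; cases d)
    (auto simp: act_def sr_le_refl mult_le_left mult_le_right
      intro: sr_le_trans[OF mult_le_left mult_le_right])

text \<open>The trivial context cannot simply be \<open>None\<close>, which is outside
  \<open>S1\<close> when S has a unity.\<close>

lemma ex_act_eq_self: "\<exists>u \<in> S1. \<forall>x :: 'a::semiring. act u x u = x"
proof -
  obtain u :: "'a option" where "u \<in> S1" "\<And>x. x \<in> S1 \<Longrightarrow> u \<cdot>\<^sub>1 x = x \<and> x \<cdot>\<^sub>1 u = x"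
    using S1_identity by blast
  moreover have "Some x \<in> S1" for x :: 'a
    by (simp add: S1_def)
  ultimately show ?thesis
    by (metis mult1_eq_act option.inject)
qed

text \<open>Translations suffice: transitivity through \<open>b + c\<close> or \<open>b * c\<close>
  changes one argument at a time.\<close>

lemma congruenceI:
  fixes r :: "('a::semiring \<times> 'a) set"
  assumes "equiv UNIV r"
    and add: "\<And>a b c. (a, b) \<in> r \<Longrightarrow> (a + c, b + c) \<in> r"
    and right: "\<And>a b c. (a, b) \<in> r \<Longrightarrow> (a * c, b * c) \<in> r"
    and left: "\<And>a b c. (a, b) \<in> r \<Longrightarrow> (c * a, c * b) \<in> r"
  shows "congruence r"
proof -
  have tr: "(x, z) \<in> r" if "(x, y) \<in> r" "(y, z) \<in> r" for x y z
    using assms(1) that by (meson equivE transE)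
  have "(a + c, b + d) \<in> r" if "(a, b) \<in> r" "(c, d) \<in> r" for a b c d
    using tr[OF add[OF that(1), of c]] add[OF that(2), of b] by (simp add: add.commute)
  moreover have "(a * c, b * d) \<in> r" if "(a, b) \<in> r" "(c, d) \<in> r" for a b c d
    using tr[OF right[OF that(1)] left[OF that(2)]] .
  ultimately show ?thesis
    using assms(1) by (simp add: congruence_def)
qed

lemma congruence_refl: "congruence r \<Longrightarrow> (x, x) \<in> r"
  by (auto simp: congruence_def equiv_def refl_on_def)

lemma congruence_sym: "congruence r \<Longrightarrow> (x, y) \<in> r \<Longrightarrow> (y, x) \<in> r"
  by (auto simp: congruence_def equiv_def sym_def)

lemma congruence_trans: "congruence r \<Longrightarrow> (x, y) \<in> r \<Longrightarrow> (y, z) \<in> r \<Longrightarrow> (x, z) \<in> r"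
  unfolding congruence_def by (meson equivE transE)

lemma congruence_add: "congruence r \<Longrightarrow> (a, b) \<in> r \<Longrightarrow> (a + c, b + c) \<in> r"
  using congruence_refl[of r c] by (auto simp: congruence_def)

lemma congruence_act: "congruence r \<Longrightarrow> (a, b) \<in> r \<Longrightarrow> (act c a d, act c b d) \<in> r"
  using congruence_refl[of r]
  by (cases c; cases d) (auto simp: act_def congruence_def)

text \<open>This is the syntactic congruence of the principal down-set of \<open>a\<close>. Additive
  contexts are omitted: a sum lies below \<open>a\<close> exactly when both summands do.\<close>

definition down_cong :: "'a::semiring \<Rightarrow> ('a \<times> 'a) set"
  where "down_cong a =
    {(x, y). \<forall>c \<in> S1. \<forall>d \<in> S1. act c x d \<preceq> a \<longleftrightarrow> act c y d \<preceq> a}"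

definition add_cong :: "'a::semiring \<Rightarrow> ('a \<times> 'a) set"
  where "add_cong a = {(x, y). x + a = y + a}"

lemma congruence_down_cong: "congruence (down_cong (a :: 'a::almost_integral_semiring))"
proof (rule congruenceI)
  show "equiv UNIV (down_cong a)"
    by (auto simp: down_cong_def intro!: equivI refl_onI symI transI)
  have S1_Some: "Some w \<in> S1" for w :: 'a
    by (simp add: S1_def)
  fix x y w :: 'a
  assume "(x, y) \<in> down_cong a"
  then have *: "act c x d \<preceq> a \<longleftrightarrow> act c y d \<preceq> a" if "c \<in> S1" "d \<in> S1" for c d
    using that by (auto simp: down_cong_def)
  show "(x + w, y + w) \<in> down_cong a"
    by (auto simp: down_cong_def act_add add_sr_le_iff *)
  show "(x * w, y * w) \<in> down_cong a"
    by (auto simp: down_cong_def act_mult_right * S1_closed S1_Some)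
  show "(w * x, w * y) \<in> down_cong a"
    by (auto simp: down_cong_def act_mult_left * S1_closed S1_Some)
qed

lemma congruence_add_cong: "congruence (add_cong (a :: 'a::almost_integral_semiring))"
proof (rule congruenceI)
  show "equiv UNIV (add_cong a)"
    by (auto simp: add_cong_def intro!: equivI refl_onI symI transI)
  fix x y w :: 'a
  assume "(x, y) \<in> add_cong a"
  then have eq: "x + a = y + a"
    by (simp add: add_cong_def)
  then show "(x + w, y + w) \<in> add_cong a"
    by (simp add: add_cong_def) (metis add.assoc add.commute)
  \<comment> \<open>Almost integrality lets \<open>a\<close> absorb its multiples, so
    \<open>t * w + a\<close> and \<open>w * t + a\<close> depend only on
    \<open>t + a\<close>.\<close>
  have "a * w + a = a" "w * a + a = a"
    using mult_le_left[of a w] mult_le_right[of w a] by (simp_all add: sr_le_def add.commute)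
  then have "t * w + a = (t + a) * w + a" "w * t + a = w * (t + a) + a" for t
    by (simp_all add: distrib_left distrib_right add.assoc)
  then show "(x * w, y * w) \<in> add_cong a" "(w * x, w * y) \<in> add_cong a"
    unfolding add_cong_def mem_Collect_eq case_prod_conv by (metis eq)+
qed

text \<open>Adding \<open>e\<close> moves only \<open>z\<close>, to \<open>e\<close>. Thus the
  relation claimed to be least is a congruence as an instance of \<open>add_cong\<close>.\<close>

lemma add_cong_least_nonzero:
  assumes z: "is_zero z" and e: "is_least_nonzero z e"
  shows "add_cong e = {(z, e), (e, z)} \<union> Id"
proof -
  have [simp]: "z + x = x" "x + z = x" for x
    using z add.commute[of z x] by (simp_all add: is_zero_def)
  have "x + e = (if x = z then e else x)" for x
    using e by (auto simp: is_least_nonzero_def sr_le_def add.commute)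
  then show ?thesis
    using e by (auto simp: add_cong_def is_least_nonzero_def split: if_splits)
qed

text \<open>A minimal element \<open>z\<close> is a zero because \<open>z * x\<close> and \<open>x * z\<close> lie below both \<open>z\<close> and \<open>x\<close>.\<close>

lemma is_zero_if_minimal:
  fixes z :: "'a::almost_integral_semiring"
  assumes "\<And>x. x \<preceq> z \<Longrightarrow> x = z"
  shows "is_zero z"
proof -
  have "z * x = z" "x * z = z" for x
    using assms mult_le_left mult_le_right by blast+
  moreover from this have "x + z = x" for x
    using mult_le_left[of x z] by (simp add: sr_le_def add.commute)
  ultimately show ?thesis
    by (simp add: is_zero_def)
qed

lemma sr_le_zero_iff: "is_zero z \<Longrightarrow> x \<preceq> z \<longleftrightarrow> x = z"
  by (auto simp: is_zero_def sr_le_def)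

definition separating :: "'a::semiring \<Rightarrow> bool"
  where "separating z \<longleftrightarrow>
    (\<forall>a b. \<not> a \<preceq> b \<longrightarrow> (\<exists>c \<in> S1. \<exists>d \<in> S1. act c a d \<noteq> z \<and> act c b d = z))"

lemma separating_if_down_cong_eq_Id:
  fixes z :: "'a::almost_integral_semiring"
  assumes z: "is_zero z" and Id: "down_cong z = Id"
  shows "separating z"
  unfolding separating_def
proof (intro allI impI)
  fix a b :: 'a
  assume "\<not> a \<preceq> b"
  then have "(a + b, b) \<notin> down_cong z"
    by (simp add: Id sr_le_def)
  then obtain c d where cd: "c \<in> S1" "d \<in> S1"
    and "\<not> (act c (a + b) d \<preceq> z \<longleftrightarrow> act c b d \<preceq> z)"
    by (auto simp: down_cong_def)
  \<comment> \<open>The product with \<open>a + b\<close> is the sum of those with \<open>a\<close>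
    and \<open>b\<close>, so only the one with \<open>b\<close> alone can lie below
    \<open>z\<close>.\<close>
  then have "\<not> act c a d \<preceq> z \<and> act c b d \<preceq> z"
    by (auto simp: act_add add_sr_le_iff)
  then have "act c a d \<noteq> z \<and> act c b d = z"
    by (simp add: sr_le_zero_iff[OF z])
  with cd show "\<exists>c \<in> S1. \<exists>d \<in> S1. act c a d \<noteq> z \<and> act c b d = z"
    by blast
qed

lemma least_nonid_congruence_structure:
  fixes s :: "('a::almost_integral_semiring \<times> 'a) set"
  assumes "is_least_nonid_congruence s"
  obtains z e :: 'a where "is_zero z" "is_least_nonzero z e" "separating z"
proof -
  have s: "congruence s" "s \<noteq> Id" and least: "\<And>r. congruence r \<Longrightarrow> r \<noteq> Id \<Longrightarrow> s \<subseteq> r"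
    using assms by (auto simp: is_least_nonid_congruence_def)
  obtain p q where pq: "(p, q) \<in> s" "p \<noteq> q"
    using s congruence_refl[OF s(1)] by auto
  \<comment> \<open>Adding \<open>p\<close> to the pair gives \<open>(p, q + p)\<close>, which is
    comparable. If its entries coincide, then \<open>q\<close> is already below
    \<open>p\<close>.\<close>
  have "\<exists>u v. (u, v) \<in> s \<and> u \<noteq> v \<and> u \<preceq> v"
  proof (cases "p = q + p")
    case True
    then show ?thesis
      using pq congruence_sym[OF s(1)] by (metis sr_le_def)
  next
    case False
    moreover have "(p, q + p) \<in> s"
      using congruence_add[OF s(1) pq(1), of p] by (simp add: add_idem)
    ultimately show ?thesis
      using sr_le_add[of p q] by (metis add.commute)
  qed
  then obtain u v where uv: "(u, v) \<in> s" "u \<noteq> v" "u \<preceq> v"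
    by blast
  \<comment> \<open>The trivial context tells \<open>u\<close> from \<open>v\<close>, since
    \<open>u\<close> is below \<open>u\<close> and \<open>v\<close> is not.\<close>
  obtain i :: "'a option" where i: "i \<in> S1" "\<And>x. act i x i = x"
    using ex_act_eq_self by blast
  have "(u, v) \<notin> down_cong u"
  proof
    assume "(u, v) \<in> down_cong u"
    then have "act i u i \<preceq> u \<longleftrightarrow> act i v i \<preceq> u"
      using i(1) unfolding down_cong_def by blast
    then have "v \<preceq> u"
      by (simp add: i(2) sr_le_refl)
    with uv show False
      using sr_le_antisym by blast
  qed
  then have Id: "down_cong u = Id"
    using least[OF congruence_down_cong] uv(1) by blast
  have "x = u" if "x \<preceq> u" for x
  proof -
    \<comment> \<open>Every context sends both \<open>x\<close> and \<open>u\<close> below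
      \<open>u\<close>, so the defining equivalence holds with both sides true.\<close>
    have "(x, u) \<in> down_cong u"
      by (auto simp: down_cong_def intro: sr_le_trans[OF act_le that] act_le)
    then show ?thesis
      by (simp add: Id)
  qed
  then have z: "is_zero u"
    by (rule is_zero_if_minimal)
  have "v \<preceq> x" if "x \<noteq> u" for x
  proof -
    have ux: "u + x = x"
      using z add.commute[of u x] by (simp add: is_zero_def)
    \<comment> \<open>Both sums with \<open>x\<close> equal \<open>x\<close>, as \<open>u\<close> is
      the zero and addition is idempotent. Membership of \<open>(u, v)\<close> will then read
      \<open>x = v + x\<close>.\<close>
    then have "(u, x) \<in> add_cong x"
      by (simp add: add_cong_def add_idem)
    with that have "add_cong x \<noteq> Id"
      by auto
    then have "(u, v) \<in> add_cong x"
      using least[OF congruence_add_cong] uv(1) by blast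
    then show ?thesis
      by (simp add: add_cong_def ux sr_le_def)
  qed
  with uv(2) have "is_least_nonzero u v"
    by (auto simp: is_least_nonzero_def)
  with z separating_if_down_cong_eq_Id[OF z Id] that show thesis
    by blast
qed

lemma is_least_nonid_congruence_if_separating:
  fixes z e :: "'a::almost_integral_semiring"
  assumes z: "is_zero z" and e: "is_least_nonzero z e" and sep: "separating z"
  shows "is_least_nonid_congruence ({(z, e), (e, z)} \<union> Id)"
proof -
  have "{(z, e), (e, z)} \<union> Id \<subseteq> r" if r: "congruence r" "r \<noteq> Id" for r
  proof -
    \<comment> \<open>By antisymmetry, a pair of distinct elements fails the order in at least one
      direction; symmetry of \<open>r\<close> allows choosing that one.\<close>
    obtain a b where ab: "(a, b) \<in> r" "\<not> a \<preceq> b"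
      using r congruence_refl[OF r(1)] congruence_sym[OF r(1)] sr_le_antisym
      by (metis subrelI pair_in_Id_conv subset_antisym)
    obtain c d where nz: "act c a d \<noteq> z" and "act c b d = z"
      using sep ab(2) unfolding separating_def by blast
    then have sz: "(act c a d, z) \<in> r"
      using congruence_act[OF r(1) ab(1), of c d] by simp
    \<comment> \<open>The nonzero product absorbs \<open>e\<close>, while \<open>z\<close> becomes
      \<open>e\<close>. So adding \<open>e\<close> to the pair \<open>sz\<close> relates the product
      to \<open>e\<close> as well as to \<open>z\<close>.\<close>
    have "act c a d + e = act c a d" "z + e = e"
      using z e nz by (auto simp: is_zero_def is_least_nonzero_def sr_le_def add.commute)
    then have "(act c a d, e) \<in> r"
      using congruence_add[OF r(1) sz, of e] by simp
    then have "(z, e) \<in> r"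
      using congruence_trans[OF r(1) congruence_sym[OF r(1) sz]] by blast
    then show ?thesis
      using congruence_sym[OF r(1)] congruence_refl[OF r(1)] by auto
  qed
  moreover have "congruence ({(z, e), (e, z)} \<union> Id)"
    using congruence_add_cong[of e] by (simp only: add_cong_least_nonzero[OF z e])
  moreover have "{(z, e), (e, z)} \<union> Id \<noteq> Id"
    using e by (auto simp: is_least_nonzero_def)
  ultimately show ?thesis
    unfolding is_least_nonid_congruence_def by blast
qed

theorem theorem4p4:
  shows "(subdirectly_irreducible TYPE('a::almost_integral_semiring) \<longleftrightarrow>
      (\<exists>z e :: 'a. is_zero z \<and> is_least_nonzero z e \<and>
        (\<forall>a b :: 'a. \<not> a \<preceq> b \<longrightarrow>
          (\<exists>c \<in> S1. \<exists>d \<in> S1. c \<cdot>\<^sub>1 Some a \<cdot>\<^sub>1 d \<noteq> Some z \<and> c \<cdot>\<^sub>1 Some b \<cdot>\<^sub>1 d = Some z)))) \<and>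
    (subdirectly_irreducible TYPE('a) \<longrightarrow>
      (\<exists>z e :: 'a. is_zero z \<and> is_least_nonzero z e \<and>
        is_least_nonid_congruence ({(z, e), (e, z)} \<union> Id)))"
  \<comment> \<open>Stripping \<open>Some\<close> from the products turns the last condition of (ii)
    into \<open>separating z\<close>.\<close>
  unfolding mult1_eq_act option.inject separating_def[symmetric] subdirectly_irreducible_def
  using least_nonid_congruence_structure is_least_nonid_congruence_if_separating
  by metis

end
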